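(* Let $f$ and $g$ be probability density functions on $[0,1]$, let $n\ge 1$ be an integer, let $M_0,\dots,M_{n-1}$ be real numbers with $M_j\ge \left|\langle x^j\rangle_f-\langle x^j\rangle_g\right|$ for $0\le j\le n-1$, and let $R_n=\langle x^{n-1}\rangle_f+\langle x^{n-1}\rangle_g$. Then for every $K>0$ the low-pass filtered functions $f^<=P_K[f]$ and $g^<=P_K[g]$ satisfy $$d(f^<,g^<)\le\frac{1}{\pi}\left\{M_0K+\frac{M_1}{2!}K^2+\dots+\frac{M_{n-1}}{n!}K^n+\frac{R_n}{(n+1)!}K^{n+1}\right\}.$$
   Context: A probability density function (PDF) on $[0,1]$ is a nonnegative Lebesgue-integrable function $f:[0,1]\to\mathbb{R}$ with $\int_0^1 f(x)\,dx=1$. Its $j$-th moment is $\langle x^j\rangle_f=\int_0^1 x^jf(x)\,dx$. Its characteristic function is $F(k)=\int_0^1 e^{ikx}f(x)\,dx$ for $k\in\mathbb{R}$; similarly $G$ is the characteristic function of $g$. For $K>0$ the low-pass filter at inverse length scale $K$ is $$P_K[f](x)=f^<(x)=\frac{1}{2\pi}\int_{-K}^{K}e^{-ikx}F(k)\,dk,$$ and likewise $g^<(x)=P_K[g](x)=\frac{1}{2\pi}\int_{-K}^{K}e^{-ikx}G(k)\,dk$. The distance between two integrable functions $u,v$ on $[0,1]$ is $$d(u,v)=\frac{\int_0^1|u(x)-v(x)|\,dx}{\int_0^1dx}=\int_0^1|u(x)-v(x)|\,dx.$$ *)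

theory Defs
  imports "HOL-Analysis.Analysis"
begin

text \<open>
  Functions on the unit interval are represented by total functions on the reals of which only
  the values on \<open>{0..1}\<close> matter. All integrals are Lebesgue integrals.
\<close>

definition pdf01 :: "(real \<Rightarrow> real) \<Rightarrow> bool" where
  "pdf01 f \<longleftrightarrow>
     (\<forall>x\<in>{0..1}. 0 \<le> f x) \<and>
     set_integrable lebesgue {0..1} f \<and>
     (LINT x:{0..1}|lebesgue. f x) = 1"

definition moment :: "(real \<Rightarrow> real) \<Rightarrow> nat \<Rightarrow> real" where
  "moment f j = (LINT x:{0..1}|lebesgue. x ^ j * f x)"

definition char_fun :: "(real \<Rightarrow> real) \<Rightarrow> real \<Rightarrow> complex" where
  "char_fun f k =
     (LINT x:{0..1}|lebesgue. exp (\<i> * complex_of_real k * complex_of_real x) * complex_of_real (f x))"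

text \<open>
  For real-valued \<open>f\<close> the filtered function has real values; it is kept complex-valued here,
  as given by its defining integral.
\<close>

definition low_pass :: "real \<Rightarrow> (real \<Rightarrow> real) \<Rightarrow> real \<Rightarrow> complex" where
  "low_pass K f x =
     1 / (2 * complex_of_real pi) *
     (LINT k:{-K..K}|lebesgue. exp (- \<i> * complex_of_real k * complex_of_real x) * char_fun f k)"

definition dist01 :: "(real \<Rightarrow> complex) \<Rightarrow> (real \<Rightarrow> complex) \<Rightarrow> real" where
  "dist01 u v = (LINT x:{0..1}|lebesgue. norm (u x - v x))"

end

theory Submission
  imports Defs "HOL-Probability.Characteristic_Functions"
begin

text \<open>
  Filtering and passing to the characteristic function are both linear, so everything concerns
  the difference \<open>h = f - g\<close>. Expanding \<open>exp (\<i> k x)\<close> in powers of \<open>k x\<close> under the integral writes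
  the characteristic function \<open>H\<close> of \<open>h\<close> as a Taylor polynomial of degree \<open>n - 1\<close> in \<open>k\<close>, whose
  \<open>j\<close>-th coefficient is \<open>\<i> ^ j / fact j\<close> times the \<open>j\<close>-th moment of \<open>h\<close> and so has modulus at most
  \<open>M j / fact j\<close>, plus a remainder of
  modulus at most \<open>\<bar>k\<bar> ^ n / fact n\<close> times the \<open>n\<close>-th absolute moment of \<open>h\<close>. As \<open>x ^ n \<le> x ^ (n - 1)\<close>
  on the unit interval and \<open>\<bar>f - g\<bar> \<le> f + g\<close>, that moment is at most \<open>R\<close>. This gives a bound for
  \<open>\<bar>H k\<bar>\<close> by a polynomial in \<open>\<bar>k\<bar>\<close> (\<open>norm_char_fun_le\<close>, \<open>moment_abs_diff_le\<close>).

  The phase in the inverse transform has modulus one, so the filtered difference is bounded,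
  uniformly in \<open>x\<close>, by the integral of that polynomial over \<open>{-K..K}\<close> divided by \<open>2 * pi\<close>
  (\<open>norm_low_pass_moment_le\<close>). Integration raises each power of \<open>\<bar>k\<bar>\<close> by one, which turns \<open>fact j\<close>
  into \<open>fact (j + 1)\<close>, and the two halves of \<open>{-K..K}\<close> contribute a factor \<open>2\<close> that leaves \<open>1 / pi\<close>.
  Since the unit interval has length one, the uniform bound is also a bound for the distance.
\<close>

section \<open>Integrals over compact intervals\<close>

lemma set_integrable_continuous_mult:
  fixes c h :: "real \<Rightarrow> 'a::{euclidean_space, real_normed_algebra}"
  assumes "continuous_on {a..b} c" and "set_integrable lebesgue {a..b} h"
  shows "set_integrable lebesgue {a..b} (\<lambda>x. c x * h x)"
proof (rule absolutely_integrable_bounded_measurable_product[OF bilinear_times])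
  show "c \<in> borel_measurable (lebesgue_on {a..b})"
    by (intro continuous_imp_measurable_on_sets_lebesgue assms) auto
  show "bounded (c ` {a..b})"
    by (intro compact_imp_bounded compact_continuous_image assms) auto
qed (use assms in auto)

lemma set_integrable_complex_of_real:
  assumes "set_integrable M A f"
  shows "set_integrable M A (\<lambda>x. complex_of_real (f x))"
  using integrable_of_real[OF assms[unfolded set_integrable_def], where 'a = complex]
  by (simp add: set_integrable_def scaleR_conv_of_real)

lemma set_integral_sum:
  fixes f :: "'i \<Rightarrow> 'a \<Rightarrow> 'b::{banach, second_countable_topology}"
  assumes "\<And>i. i \<in> I \<Longrightarrow> set_integrable M A (f i)"
  shows "set_integrable M A (\<lambda>x. \<Sum>i\<in>I. f i x)"
    and "(LINT x:A|M. \<Sum>i\<in>I. f i x) = (\<Sum>i\<in>I. LINT x:A|M. f i x)"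
  using assms unfolding set_integrable_def set_lebesgue_integral_def
  by (simp_all add: scaleR_sum_right)

lemma set_integral_norm_le:
  fixes f :: "'a \<Rightarrow> 'b::{banach, second_countable_topology}"
  assumes "set_integrable M A f" and "set_integrable M A g"
    and "\<And>x. x \<in> A \<Longrightarrow> norm (f x) \<le> g x"
  shows "norm (LINT x:A|M. f x) \<le> (LINT x:A|M. g x)"
proof -
  have "norm (LINT x:A|M. f x) \<le> (LINT x:A|M. norm (f x))"
    by (rule set_integral_norm_bound[OF assms(1)])
  also have "\<dots> \<le> (LINT x:A|M. g x)"
    by (intro set_integral_mono set_integrable_norm assms)
  finally show ?thesis .
qed

text \<open>
  The antiderivative of \<open>\<bar>k\<bar> ^ j\<close> changes its form at \<open>0\<close>, so the right half of the interval is
  integrated by the fundamental theorem and the left half is obtained by reflection.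
\<close>

lemma set_integral_abs_power_symmetric:
  fixes K :: real
  assumes "K \<ge> 0"
  shows "(LINT k:{-K..K}|lebesgue. \<bar>k\<bar> ^ j) = 2 * K ^ (j + 1) / (j + 1)"
proof -
  have pos: "((\<lambda>k. \<bar>k\<bar> ^ j) has_integral K ^ (j + 1) / (j + 1)) {0..K}"
  proof -
    have "((\<lambda>k. k ^ (j + 1) / (j + 1)) has_real_derivative x ^ j) (at x within {0..K})" for x
      using DERIV_cdivide[OF DERIV_pow[of "j + 1" x "{0..K}"], of "real (j + 1)"]
      by (simp add: nonzero_mult_div_cancel_left[of "real (Suc j)"] del: of_nat_Suc power_Suc)
    then have "((\<lambda>k. k ^ j) has_integral K ^ (j + 1) / (j + 1) - 0 ^ (j + 1) / (j + 1)) {0..K}"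
      using assms
      by (intro fundamental_theorem_of_calculus)
         (simp_all flip: has_real_derivative_iff_has_vector_derivative del: power_Suc)
    then show ?thesis
      by (auto intro: has_integral_eq)
  qed
  then have "((\<lambda>k. \<bar>k\<bar> ^ j) has_integral K ^ (j + 1) / (j + 1)) {-K..0}"
    using has_integral_reflect_real[where a = 0 and b = K and f = "\<lambda>k. \<bar>k\<bar> ^ j"]
    by (simp del: power_Suc)
  then have "((\<lambda>k. \<bar>k\<bar> ^ j) has_integral K ^ (j + 1) / (j + 1) + K ^ (j + 1) / (j + 1)) {-K..K}"
    using assms pos by (intro has_integral_combine[where c = 0]) auto
  moreover have "set_integrable lebesgue {-K..K} (\<lambda>k. \<bar>k\<bar> ^ j)"
    by (intro absolutely_integrable_continuous_real continuous_intros)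
  ultimately show ?thesis
    by (simp add: set_lebesgue_integral_eq_integral integral_unique del: power_Suc)
qed

section \<open>Taylor expansion of the characteristic function\<close>

lemma set_integrable_iexp_mult:
  assumes "set_integrable lebesgue {0..1} h"
  shows "set_integrable lebesgue {0..1}
    (\<lambda>x. exp (\<i> * complex_of_real k * complex_of_real x) * complex_of_real (h x))"
  by (intro set_integrable_continuous_mult set_integrable_complex_of_real assms continuous_intros)

lemma char_fun_diff:
  assumes "set_integrable lebesgue {0..1} f" and "set_integrable lebesgue {0..1} g"
  shows "char_fun (\<lambda>x. f x - g x) k = char_fun f k - char_fun g k"
  unfolding char_fun_def of_real_diff right_diff_distrib
  by (intro set_integral_diff set_integrable_iexp_mult assms)

lemma moment_diff:
  assumes "set_integrable lebesgue {0..1} f" and "set_integrable lebesgue {0..1} g"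
  shows "moment (\<lambda>x. f x - g x) j = moment f j - moment g j"
  unfolding moment_def right_diff_distrib
  by (intro set_integral_diff set_integrable_continuous_mult assms continuous_intros)

text \<open>This is the Taylor estimate of order \<open>0\<close> at \<open>s - t\<close>, rotated by a number of modulus one.\<close>

lemma norm_iexp_diff_le: "cmod (exp (\<i> * of_real s) - exp (\<i> * of_real t)) \<le> \<bar>s - t\<bar>"
proof -
  have "exp (\<i> * of_real s) - exp (\<i> * of_real t)
      = exp (\<i> * of_real t) * (exp (\<i> * of_real (s - t)) - 1)"
    by (simp add: right_diff_distrib flip: exp_add)
  moreover have "cmod (exp (\<i> * of_real (s - t)) - 1) \<le> \<bar>s - t\<bar>"
    using iexp_approx1[of "s - t" 0] by simp
  ultimately show ?thesis
    by (simp add: norm_mult)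
qed

text \<open>
  Continuity makes the characteristic function integrable over \<open>{-K..K}\<close>; the linearity of the
  filter rests on this. It follows from Lipschitz continuity: on the unit interval
  \<open>exp (\<i> k x)\<close> is \<open>1\<close>-Lipschitz in \<open>k\<close>, so the \<open>L1\<close> norm of \<open>h\<close> is a Lipschitz constant.
\<close>

lemma continuous_char_fun:
  assumes h: "set_integrable lebesgue {0..1} h"
  shows "continuous_on S (char_fun h)"
proof -
  define L where "L = (LINT x:{0..1}|lebesgue. \<bar>h x\<bar>)"
  have "L-lipschitz_on UNIV (char_fun h)"
  proof (rule lipschitz_onI)
    fix k l :: real
    let ?E = "\<lambda>k x. exp (\<i> * complex_of_real k * complex_of_real x)"
    have "char_fun h k - char_fun h l = (LINT x:{0..1}|lebesgue. (?E k x - ?E l x) * of_real (h x))"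
      unfolding char_fun_def left_diff_distrib
      by (intro set_integral_diff(2)[symmetric] set_integrable_iexp_mult h)
    also have "cmod \<dots> \<le> (LINT x:{0..1}|lebesgue. \<bar>k - l\<bar> * \<bar>h x\<bar>)"
    proof (rule set_integral_norm_le)
      show "set_integrable lebesgue {0..1} (\<lambda>x. (?E k x - ?E l x) * of_real (h x))"
        unfolding left_diff_distrib by (intro set_integral_diff set_integrable_iexp_mult h)
      show "set_integrable lebesgue {0..1} (\<lambda>x. \<bar>k - l\<bar> * \<bar>h x\<bar>)"
        by (intro set_integrable_mult_right set_integrable_abs h)
    next
      fix x :: real assume x: "x \<in> {0..1}"
      have "cmod (?E k x - ?E l x) \<le> \<bar>k * x - l * x\<bar>"
        using norm_iexp_diff_le[of "k * x" "l * x"] by (simp add: mult.assoc)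
      also have "\<dots> \<le> \<bar>k - l\<bar>"
        using x by (simp add: abs_mult mult_left_le flip: left_diff_distrib)
      finally show "cmod ((?E k x - ?E l x) * of_real (h x)) \<le> \<bar>k - l\<bar> * \<bar>h x\<bar>"
        by (simp add: norm_mult mult_right_mono)
    qed
    finally show "dist (char_fun h k) (char_fun h l) \<le> L * dist k l"
      by (simp add: dist_norm L_def mult.commute)
  qed (auto simp: L_def set_lebesgue_integral_def intro!: integral_nonneg_AE)
  then show ?thesis
    using lipschitz_on_continuous_on continuous_on_subset by blast
qed

text \<open>
  Integrating the pointwise Taylor remainder \<open>\<bar>k x\<bar> ^ (m + 1) / fact (m + 1)\<close> against \<open>\<bar>h\<bar>\<close> would
  produce the absolute moment of order \<open>m + 1\<close>. Giving away one factor \<open>x \<le> 1\<close> replaces it by that of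
  order \<open>m\<close>, so that only moments up to the order of the Taylor polynomial occur.
\<close>

lemma char_fun_taylor:
  assumes h: "set_integrable lebesgue {0..1} h"
  shows "cmod (char_fun h k - (\<Sum>j\<le>m. (\<i> * of_real k) ^ j / fact j * of_real (moment h j)))
    \<le> \<bar>k\<bar> ^ (m + 1) / fact (m + 1) * moment (\<lambda>x. \<bar>h x\<bar>) m"
proof -
  let ?E = "\<lambda>x. exp (\<i> * complex_of_real k * complex_of_real x) * complex_of_real (h x)"
  let ?T = "\<lambda>j x. (\<i> * complex_of_real k) ^ j / fact j * complex_of_real (x ^ j * h x)"
  have T: "set_integrable lebesgue {0..1} (?T j)" for j
    by (intro set_integrable_mult_right set_integrable_complex_of_real
        set_integrable_continuous_mult h continuous_intros)
  have "(\<Sum>j\<le>m. (\<i> * of_real k) ^ j / fact j * of_real (moment h j))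
      = (LINT x:{0..1}|lebesgue. \<Sum>j\<le>m. ?T j x)"
    by (simp only: moment_def set_integral_sum(2)[OF T] set_integral_mult_right
        set_integral_complex_of_real)
  then have "char_fun h k - (\<Sum>j\<le>m. (\<i> * of_real k) ^ j / fact j * of_real (moment h j))
      = (LINT x:{0..1}|lebesgue. ?E x - (\<Sum>j\<le>m. ?T j x))"
    by (simp only: char_fun_def set_integral_diff(2)[OF set_integrable_iexp_mult[OF h]
          set_integral_sum(1)[OF T]])
  also have "cmod \<dots> \<le> (LINT x:{0..1}|lebesgue. \<bar>k\<bar> ^ (m + 1) / fact (m + 1) * (x ^ m * \<bar>h x\<bar>))"
  proof (rule set_integral_norm_le)
    show "set_integrable lebesgue {0..1} (\<lambda>x. ?E x - (\<Sum>j\<le>m. ?T j x))"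
      by (intro set_integral_diff set_integrable_iexp_mult set_integral_sum T h)
    show "set_integrable lebesgue {0..1} (\<lambda>x. \<bar>k\<bar> ^ (m + 1) / fact (m + 1) * (x ^ m * \<bar>h x\<bar>))"
      by (intro set_integrable_mult_right set_integrable_continuous_mult set_integrable_abs h
          continuous_intros)
  next
    fix x :: real assume x: "x \<in> {0..1}"
    have "?E x - (\<Sum>j\<le>m. ?T j x)
        = (exp (\<i> * of_real (k * x)) - (\<Sum>j\<le>m. (\<i> * of_real (k * x)) ^ j / fact j)) * of_real (h x)"
      by (simp add: right_diff_distrib sum_distrib_left power_mult_distrib mult_ac)
    also have "cmod \<dots> \<le> \<bar>k * x\<bar> ^ (m + 1) / fact (m + 1) * \<bar>h x\<bar>"
      using mult_right_mono[OF iexp_approx1[of "k * x" m], of "\<bar>h x\<bar>"]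
      by (simp add: norm_mult del: power_Suc fact_Suc)
    also have "\<bar>k * x\<bar> ^ (m + 1) = \<bar>k\<bar> ^ (m + 1) * x ^ (m + 1)"
      using x by (simp add: abs_mult power_mult_distrib)
    also have "\<bar>k\<bar> ^ (m + 1) * x ^ (m + 1) / fact (m + 1) * \<bar>h x\<bar>
        \<le> \<bar>k\<bar> ^ (m + 1) * x ^ m / fact (m + 1) * \<bar>h x\<bar>"
      using x by (intro mult_right_mono divide_right_mono mult_left_mono power_decreasing) auto
    finally show "cmod (?E x - (\<Sum>j\<le>m. ?T j x)) \<le> \<bar>k\<bar> ^ (m + 1) / fact (m + 1) * (x ^ m * \<bar>h x\<bar>)"
      by simp
  qed
  finally show ?thesis
    by (simp only: moment_def set_integral_mult_right)
qed

lemma norm_char_fun_le: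
  assumes h: "set_integrable lebesgue {0..1} h"
  shows "cmod (char_fun h k) \<le> (\<Sum>j\<le>m. \<bar>moment h j\<bar> / fact j * \<bar>k\<bar> ^ j)
    + moment (\<lambda>x. \<bar>h x\<bar>) m / fact (m + 1) * \<bar>k\<bar> ^ (m + 1)"
proof -
  let ?S = "\<Sum>j\<le>m. (\<i> * of_real k) ^ j / fact j * of_real (moment h j)"
  have "cmod (char_fun h k) \<le> cmod ?S + cmod (char_fun h k - ?S)"
    by (rule norm_triangle_sub)
  moreover have "cmod ?S \<le> (\<Sum>j\<le>m. \<bar>moment h j\<bar> / fact j * \<bar>k\<bar> ^ j)"
    by (rule sum_norm_le) (simp add: norm_mult norm_divide norm_power mult.commute)
  ultimately show ?thesis
    using char_fun_taylor[OF h, of k m] by (simp add: mult.commute)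
qed

section \<open>The low-pass filter\<close>

lemma set_integrable_low_pass:
  assumes "set_integrable lebesgue {0..1} h"
  shows "set_integrable lebesgue {-K..K}
    (\<lambda>k. exp (- \<i> * complex_of_real k * complex_of_real x) * char_fun h k)"
  by (intro absolutely_integrable_continuous_real continuous_intros continuous_char_fun assms)

lemma low_pass_diff:
  assumes "set_integrable lebesgue {0..1} f" and "set_integrable lebesgue {0..1} g"
  shows "low_pass K (\<lambda>x. f x - g x) x = low_pass K f x - low_pass K g x"
  unfolding low_pass_def char_fun_diff[OF assms] right_diff_distrib
  by (simp only: set_integral_diff(2)[OF set_integrable_low_pass set_integrable_low_pass] assms
      right_diff_distrib)

lemma norm_low_pass_le:
  assumes h: "set_integrable lebesgue {0..1} h"
    and b: "set_integrable lebesgue {-K..K} b"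
    and le: "\<And>k. k \<in> {-K..K} \<Longrightarrow> cmod (char_fun h k) \<le> b k"
  shows "cmod (low_pass K h x) \<le> (LINT k:{-K..K}|lebesgue. b k) / (2 * pi)"
proof -
  have "cmod (LINT k:{-K..K}|lebesgue. exp (- \<i> * complex_of_real k * complex_of_real x) * char_fun h k)
      \<le> (LINT k:{-K..K}|lebesgue. b k)"
    by (intro set_integral_norm_le set_integrable_low_pass h b) (simp add: norm_mult le)
  then show ?thesis
    by (simp add: low_pass_def norm_mult norm_divide divide_right_mono)
qed

text \<open>
  The polynomial bound for the characteristic function is integrated term by term; the factor \<open>2\<close>
  from the symmetric interval cancels against the normalisation \<open>1 / (2 * pi)\<close> of the filter.
\<close>

lemma norm_low_pass_moment_le:
  assumes h: "set_integrable lebesgue {0..1} h" and K: "K \<ge> 0"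
  shows "cmod (low_pass K h x) \<le> 1 / pi * ((\<Sum>j\<le>m. \<bar>moment h j\<bar> / fact (j + 1) * K ^ (j + 1))
    + moment (\<lambda>x. \<bar>h x\<bar>) m / fact (m + 2) * K ^ (m + 2))"
proof -
  define b where "b k = (\<Sum>j\<le>m. \<bar>moment h j\<bar> / fact j * \<bar>k\<bar> ^ j)
    + moment (\<lambda>x. \<bar>h x\<bar>) m / fact (m + 1) * \<bar>k\<bar> ^ (m + 1)" for k :: real
  have p: "set_integrable lebesgue {-K..K} (\<lambda>k. c * \<bar>k\<bar> ^ j)" for c :: real and j
    by (intro absolutely_integrable_continuous_real continuous_intros)
  have i: "(LINT k:{-K..K}|lebesgue. c / fact j * \<bar>k\<bar> ^ j)
      = 2 * (c / fact (j + 1) * K ^ (j + 1))" for c :: real and j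
    using K by (simp add: set_integral_abs_power_symmetric field_simps del: power_Suc)
  have "(LINT k:{-K..K}|lebesgue. b k)
      = 2 * ((\<Sum>j\<le>m. \<bar>moment h j\<bar> / fact (j + 1) * K ^ (j + 1))
          + moment (\<lambda>x. \<bar>h x\<bar>) m / fact (m + 2) * K ^ (m + 2))"
    unfolding b_def set_integral_add(2)[OF set_integral_sum(1)[OF p] p] set_integral_sum(2)[OF p] i
    by (simp add: sum_distrib_left distrib_left del: power_Suc fact_Suc)
  moreover have "cmod (low_pass K h x) \<le> (LINT k:{-K..K}|lebesgue. b k) / (2 * pi)"
    using norm_char_fun_le[OF h]
    unfolding b_def by (intro norm_low_pass_le h set_integral_add set_integral_sum p) blast
  ultimately show ?thesis
    by (simp only: mult_divide_mult_cancel_left_if) simp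
qed

section \<open>The distance of the filtered densities\<close>

lemma dist01_le:
  assumes "\<And>x. x \<in> {0..1} \<Longrightarrow> cmod (u x - v x) \<le> B"
  shows "dist01 u v \<le> B"
proof -
  have "0 \<le> B"
    using order_trans[OF norm_ge_zero assms[of 0]] by simp
  have "dist01 u v \<le> (LINT x:{0..1::real}|lebesgue. B)"
    unfolding dist01_def set_lebesgue_integral_def
  \<comment> \<open>This covers a non-integrable integrand as well: its integral is \<open>0\<close> by convention.\<close>
  proof (rule integral_mono')
    show "integrable lebesgue (\<lambda>x. indicator {0..1::real} x *\<^sub>R B)"
      unfolding set_integrable_def[symmetric]
      by (intro absolutely_integrable_continuous_real continuous_intros)
  qed (use \<open>0 \<le> B\<close> assms in \<open>auto simp: indicator_def\<close>)
  also have "\<dots> = B"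
    by (simp add: set_lebesgue_integral_def)
  finally show ?thesis .
qed

lemma moment_abs_diff_le:
  assumes "pdf01 f" and "pdf01 g"
  shows "moment (\<lambda>x. \<bar>f x - g x\<bar>) j \<le> moment f j + moment g j"
proof -
  have f: "set_integrable lebesgue {0..1} f" and g: "set_integrable lebesgue {0..1} g"
    using assms by (auto simp: pdf01_def)
  have x: "continuous_on {0..1} (\<lambda>x::real. x ^ j)"
    by (intro continuous_intros)
  have "moment (\<lambda>x. \<bar>f x - g x\<bar>) j \<le> (LINT x:{0..1}|lebesgue. x ^ j * f x + x ^ j * g x)"
    unfolding moment_def
  proof (rule set_integral_mono)
    fix x :: real assume "x \<in> {0..1}"
    then have "0 \<le> x ^ j" "\<bar>f x - g x\<bar> \<le> f x + g x"
      using assms by (auto simp: pdf01_def abs_le_iff add_increasing add_increasing2)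
    then show "x ^ j * \<bar>f x - g x\<bar> \<le> x ^ j * f x + x ^ j * g x"
      by (metis distrib_left mult_left_mono)
  qed (intro set_integrable_continuous_mult[OF x] set_integrable_abs set_integral_diff
      set_integral_add f g)+
  also have "\<dots> = moment f j + moment g j"
    unfolding moment_def
    by (intro set_integral_add set_integrable_continuous_mult[OF x] f g)
  finally show ?thesis .
qed

theorem mainTheorem2:
  fixes f g :: "real \<Rightarrow> real" and n :: nat and M :: "nat \<Rightarrow> real" and R K :: real
  assumes "pdf01 f" and "pdf01 g"
    and "n \<ge> 1"
    and "\<And>j. j \<le> n - 1 \<Longrightarrow> M j \<ge> \<bar>moment f j - moment g j\<bar>"
    and "R = moment f (n - 1) + moment g (n - 1)"
    and "K > 0"
  shows "dist01 (low_pass K f) (low_pass K g)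
    \<le> 1 / pi * ((\<Sum>j=0..n-1. M j / fact (j + 1) * K ^ (j + 1))
                 + R / fact (n + 1) * K ^ (n + 1))"
proof (rule dist01_le)
  fix x :: real
  define h where "h x = f x - g x" for x
  have f: "set_integrable lebesgue {0..1} f" and g: "set_integrable lebesgue {0..1} g"
    using assms by (auto simp: pdf01_def)
  then have h: "set_integrable lebesgue {0..1} h"
    unfolding h_def by (rule set_integral_diff)
  have moment_h: "\<bar>moment h j\<bar> \<le> M j" if "j \<le> n - 1" for j
    using assms(4)[OF that] by (simp add: h_def[abs_def] moment_diff[OF f g])
  have moment_abs_h: "moment (\<lambda>x. \<bar>h x\<bar>) (n - 1) \<le> R"
    using moment_abs_diff_le[OF assms(1,2)] by (simp add: h_def assms(5))
  have n: "n - 1 + 2 = n + 1"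
    using assms(3) by simp
  have "cmod (low_pass K f x - low_pass K g x) = cmod (low_pass K h x)"
    by (simp add: h_def[abs_def] low_pass_diff[OF f g])
  also have "\<dots> \<le> 1 / pi * ((\<Sum>j\<le>n-1. \<bar>moment h j\<bar> / fact (j + 1) * K ^ (j + 1))
      + moment (\<lambda>x. \<bar>h x\<bar>) (n - 1) / fact (n + 1) * K ^ (n + 1))"
    using norm_low_pass_moment_le[OF h, of K x "n - 1"] assms(6) unfolding n by simp
  also have "\<dots> \<le> 1 / pi * ((\<Sum>j\<le>n-1. M j / fact (j + 1) * K ^ (j + 1))
      + R / fact (n + 1) * K ^ (n + 1))"
    using assms(6) moment_h moment_abs_h
    by (intro mult_left_mono add_mono sum_mono mult_right_mono divide_right_mono) auto
  finally show "cmod (low_pass K f x - low_pass K g x)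
    \<le> 1 / pi * ((\<Sum>j=0..n-1. M j / fact (j + 1) * K ^ (j + 1)) + R / fact (n + 1) * K ^ (n + 1))"
    by (simp add: atMost_atLeast0)
qed

end
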